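(* Let $0\le v_1<\cdots<v_n$ be real numbers, $v=(v_1,\ldots,v_n)$, and let $J\subset\{1,\ldots,n\}$. If $1\le|J|\le n-4$ and $j>2$ for all $j\in J$, then the inequality $$\sum_{j\in J}x_j\ \ge\ \sum_{j=1}^{|J|}v_j$$ defines a facet of $H_n(v)$.
   Context: A point $x=(x_1,\ldots,x_n)\in\{v_1,\ldots,v_n\}^n$ is a circuit if the map $\sigma$ on $\{1,\ldots,n\}$ defined by $x_i=v_{\sigma(i)}$ is a permutation consisting of a single $n$-cycle. The hamiltonian circuit polytope $H_n(v)\subset\mathbb{R}^n$ is the convex hull of all circuits. An inequality defines a facet of $H_n(v)$ if it is satisfied by all points of $H_n(v)$ and the set of points of $H_n(v)$ satisfying it at equality is a face of dimension $\dim H_n(v)-1$. *)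

theory Defs
  imports "HOL-Analysis.Analysis" "HOL-Combinatorics.Orbits"
begin

(* The coordinates of R^n are numbered by a bijection e from {1..n} onto the index type,
   n = CARD('n); the i-th coordinate of x is x $ e i.  Only v 1, ..., v n matter. *)
definition is_circuit :: "(nat \<Rightarrow> 'n::finite) \<Rightarrow> (nat \<Rightarrow> real) \<Rightarrow> real ^ 'n \<Rightarrow> bool" where
  "is_circuit e v x \<longleftrightarrow>
     (\<exists>\<sigma>. \<sigma> permutes {1..CARD('n)} \<and> cyclic_on \<sigma> {1..CARD('n)} \<and>
          (\<forall>i\<in>{1..CARD('n)}. x $ e i = v (\<sigma> i)))"

definition circuit_polytope :: "(nat \<Rightarrow> 'n::finite) \<Rightarrow> (nat \<Rightarrow> real) \<Rightarrow> (real ^ 'n) set" where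
  "circuit_polytope e v = convex hull {x. is_circuit e v x}"

definition defines_facet :: "'a::euclidean_space set \<Rightarrow> ('a \<Rightarrow> real) \<Rightarrow> real \<Rightarrow> bool" where
  "defines_facet P f b \<longleftrightarrow> (\<forall>x\<in>P. f x \<ge> b) \<and> {x \<in> P. f x = b} facet_of P"

end

theory Submission
  imports Defs
begin

text \<open>
  Let \<^term>\<open>m = card J\<close>. A circuit takes distinct values on \<open>J\<close>, so its coordinates over \<open>J\<close> sum to
  at least \<open>v 1 + \<dots> + v m\<close>, with equality exactly when \<open>\<sigma>\<close> maps \<open>J\<close> onto \<open>{1..m}\<close>. The circuits
  satisfying this are the tight ones. What has to be shown is that there are enough of them:
  a vector \<open>a\<close> whose inner product with every tight circuit is the same must be constant on \<open>J\<close> and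
  constant on the complement of \<open>J\<close> (lemma \<open>weights_two_valued\<close>). These vectors form a space of
  dimension at most 2, so the tight circuits span an affine space of dimension at least \<open>n - 2\<close>. The
  polytope lies in the hyperplane of points with coordinate sum \<open>v 1 + \<dots> + v n\<close> and is not contained
  in the face, so the dimensions of face and polytope can only be \<open>n - 2\<close> and \<open>n - 1\<close>.

  For the complement of \<open>J\<close>, the values of \<open>\<sigma>\<close> on \<open>J\<close> are fixed to be an acyclic injection \<open>f\<close>.
  Contracting the arcs \<open>x \<rightarrow> f x\<close> one by one turns the \<open>n\<close>-cycles that extend \<open>f\<close> into all
  Hamiltonian cycles on the at least four remaining nodes, with the values \<open>v\<close> redistributed
  injectively among these nodes. The same contraction reduces any number of nodes to four, and for
  four nodes the six Hamiltonian cycles give a linear system that is solved by hand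
  (\<open>weights_constant_four_algebra\<close>).

  For \<open>J\<close> itself there may be only two or three nodes, too few for the same argument, but now the
  complement contributes only a constant, and every acyclic bijection from \<open>J\<close> to \<open>{1..m}\<close> extends
  to a tight circuit. Here the hypothesis that 1 and 2 are not in \<open>J\<close> enters: the \<open>k\<close>-th smallest
  element \<open>x\<close> of \<open>J\<close> is at least \<open>k + 2\<close>, so mapping it to \<open>k\<close> decreases every node by two or more.
  Exchanging the values \<open>k\<close> and \<open>k + 1\<close> still decreases every node and therefore keeps the map acyclic.
  Comparing the two circuits shows that \<open>a\<close> agrees on consecutive elements of \<open>J\<close>.
\<close>

section \<open>Inserting a node into a cycle\<close>

text \<open>The plain name \<open>transpose\<close> denotes the matrix operation here.\<close>

abbreviation transposition :: "'a \<Rightarrow> 'a \<Rightarrow> 'a \<Rightarrow> 'a" where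
  "transposition \<equiv> Transposition.transpose"

definition single_cycle :: "('a \<Rightarrow> 'a) \<Rightarrow> 'a set \<Rightarrow> bool" where
  "single_cycle \<sigma> V \<longleftrightarrow> \<sigma> permutes V \<and> cyclic_on \<sigma> V"

lemma single_cycle_singleton: "single_cycle id {x}"
  unfolding single_cycle_def cyclic_on_def using orbit_eq_singleton_iff[of id x]
  by (auto simp: permutes_id)

text \<open>
  Subdividing the arc of \<open>\<tau>\<close> that enters \<open>d\<close>: its source is redirected to \<open>c\<close>, and \<open>c\<close> is mapped
  to \<open>d\<close>. Read backwards, this contracts the arc \<open>c \<rightarrow> d\<close>.
\<close>

lemma single_cycle_insert:
  assumes \<tau>: "single_cycle \<tau> V" and c: "c \<notin> V" and d: "d \<in> V"
  shows "single_cycle (transposition c d \<circ> \<tau>) (insert c V)"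
proof -
  define \<sigma> where "\<sigma> = transposition c d \<circ> \<tau>"
  have perm: "\<tau> permutes V" and cyc: "cyclic_on \<tau> V"
    using \<tau> by (auto simp: single_cycle_def)
  have fin: "finite V" using cyc by (rule finite_cyclic_on)
  have perm': "\<sigma> permutes insert c V"
    unfolding \<sigma>_def using perm d by (intro permutes_compose permutes_swap_id) (auto intro: permutes_subset)
  have \<sigma>c: "\<sigma> c = d"
    using permutes_not_in[OF perm c] by (simp add: \<sigma>_def)
  have step: "\<sigma> y = \<tau> y" if "y \<in> V" "\<tau> y \<noteq> d" for y
    using that c permutes_in_image[OF perm, of y] by (auto simp: \<sigma>_def Transposition.transpose_def)
  have dc: "d \<in> orbit \<sigma> c" using orbit.base[of \<sigma> c] \<sigma>c by simp
  have "y \<in> orbit \<sigma> c \<and> y \<in> V" if "y \<in> orbit \<tau> d" for y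
    using that
  proof induction
    case base
    show ?case using dc d step[OF d] orbit.step[OF dc] permutes_in_image[OF perm, of d]
      by (cases "\<tau> d = d") auto
  next
    case (step y)
    then show ?case using dc \<open>\<And>y. \<lbrakk>y \<in> V; \<tau> y \<noteq> d\<rbrakk> \<Longrightarrow> \<sigma> y = \<tau> y\<close>[of y]
        orbit.step[of y \<sigma> c] permutes_in_image[OF perm, of y]
      by (cases "\<tau> y = d") auto
  qed
  then have "V \<subseteq> orbit \<sigma> c" using orbit_cyclic_eq3[OF cyc d] by auto
  moreover have "c \<in> orbit \<sigma> c"
    using perm' fin by (intro permutation_self_in_orbit) (auto simp: permutation_permutes)
  moreover have "orbit \<sigma> c \<subseteq> insert c V"
    by (rule permutes_orbit_subset[OF perm']) simp
  ultimately have "insert c V = orbit \<sigma> c" by auto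
  then have "cyclic_on \<sigma> (insert c V)" unfolding cyclic_on_def by blast
  then show ?thesis using perm' by (simp add: single_cycle_def \<sigma>_def)
qed

text \<open>
  The effect of the contraction on the objective: the arc \<open>c \<rightarrow> d\<close> contributes a constant, and in the
  smaller problem the node \<open>d\<close> carries the value of \<open>c\<close>, because an arc into \<open>d\<close> stands for an arc
  into \<open>c\<close>.
\<close>

lemma sum_insert_node:
  fixes a w :: "'a \<Rightarrow> real"
  assumes "single_cycle \<tau> V" "c \<notin> V"
  shows "(\<Sum>x\<in>insert c V. a x * w ((transposition c d \<circ> \<tau>) x))
       = a c * w d + (\<Sum>x\<in>V. a x * (w \<circ> transposition c d) (\<tau> x))"
proof -
  have "finite V" "\<tau> c = c"
    using assms finite_cyclic_on permutes_not_in by (auto simp: single_cycle_def)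
  then show ?thesis using assms(2) by simp
qed

section \<open>Weights that do not distinguish Hamiltonian cycles\<close>

text \<open>
  The six Hamiltonian cycles on four nodes come in three pairs of mutually reverse cycles. The
  objective of both cycles of a pair agrees whenever \<open>a = \<alpha> w + \<beta>\<close>, and conversely these three equations
  force \<open>a\<close> to have this form. For such \<open>a\<close> the difference between two pairs is \<open>\<alpha>\<close> times a product of
  differences of values, hence \<open>\<alpha> = 0\<close>.
\<close>

lemma weights_constant_four_algebra:
  fixes a1 a2 a3 a4 w1 w2 w3 w4 :: real
  assumes ne: "w1 \<noteq> w2" "w1 \<noteq> w4" "w2 \<noteq> w3"
    and c1234: "a1*w2 + a2*w3 + a3*w4 + a4*w1 = b"
    and c4321: "a2*w1 + a3*w2 + a4*w3 + a1*w4 = b"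
    and c1324: "a1*w3 + a3*w2 + a2*w4 + a4*w1 = b"
    and c4231: "a3*w1 + a2*w3 + a4*w2 + a1*w4 = b"
    and c1243: "a1*w2 + a2*w4 + a4*w3 + a3*w1 = b"
    and c3421: "a2*w1 + a4*w2 + a3*w4 + a1*w3 = b"
  shows "a1 = a2"
proof -
  \<comment> \<open>The affine function of the values that fits \<open>a1\<close> and \<open>a2\<close>; \<open>e3\<close> and \<open>e4\<close> are its errors at \<open>a3\<close> and \<open>a4\<close>.\<close>
  define \<alpha> \<beta> where "\<alpha> = (a1 - a2) / (w1 - w2)" and "\<beta> = a1 - \<alpha> * w1"
  define e3 e4 where "e3 = a3 - \<alpha> * w3 - \<beta>" and "e4 = a4 - \<alpha> * w4 - \<beta>"
  have d: "\<alpha> * (w1 - w2) = a1 - a2" using ne by (simp add: \<alpha>_def)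
  have a: "a1 = \<alpha> * w1 + \<beta>" "a2 = \<alpha> * w2 + \<beta>" "a3 = \<alpha> * w3 + \<beta> + e3" "a4 = \<alpha> * w4 + \<beta> + e4"
    using d by (simp_all add: \<beta>_def e3_def e4_def algebra_simps)
  have "(e3 - e4) * (w1 - w2) = 0"
    using c1324 c4231 unfolding a by (simp add: algebra_simps)
  then have e34: "e4 = e3" using ne by simp
  have "e3 * ((w2 - w4) - (w1 - w3)) = 0"
    using c1234 c4321 unfolding a e34 by (simp add: algebra_simps)
  moreover have "e3 * ((w2 - w3) - (w1 - w4)) = 0"
    using c1243 c3421 unfolding a e34 by (simp add: algebra_simps)
  ultimately have "e3 * (w1 - w2) = 0" by (simp only: algebra_simps)
  then have e3: "e3 = 0" using ne by simp
  have "\<alpha> * ((w1 - w4) * (w2 - w3)) = 0"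
    using c1234 c1243 c1324 unfolding a e34 e3 by (simp add: algebra_simps)
  then have "\<alpha> = 0" using ne by simp
  then show ?thesis using a by simp
qed

text \<open>All six cycles arise by inserting \<open>r\<close> and then \<open>s\<close> into the cycle on \<open>p\<close> and \<open>q\<close>.\<close>

lemma weights_constant_four:
  fixes a w :: "'a \<Rightarrow> real"
  assumes dist: "distinct [p, q, r, s]" and V: "V = {p, q, r, s}" and w: "inj_on w V"
    and const: "\<And>\<sigma>. single_cycle \<sigma> V \<Longrightarrow> (\<Sum>x\<in>V. a x * w (\<sigma> x)) = b"
  shows "a p = a q"
proof -
  have cyc: "single_cycle (transposition s z \<circ> (transposition r y \<circ> transposition q p)) V"
    if "y \<in> {p, q}" "z \<in> {p, q, r}" for y z
  proof -
    have "single_cycle (transposition q p) {q, p}"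
      using single_cycle_insert[OF single_cycle_singleton[of p], of q p] dist by auto
    from single_cycle_insert[OF this, of r y]
    have "single_cycle (transposition r y \<circ> transposition q p) {r, q, p}"
      using dist that by auto
    from single_cycle_insert[OF this, of s z] show ?thesis
      using dist that unfolding V by (auto simp: insert_commute)
  qed
  have ne: "w p \<noteq> w q" "w p \<noteq> w s" "w q \<noteq> w r"
    using w dist unfolding V by (auto dest: inj_onD)
  note c = const[OF cyc]
  have eqs: "z \<in> {p,q,r} \<Longrightarrow> y \<in> {p,q} \<Longrightarrow> 
    a p * w (transposition s z (transposition r y q)) + a q * w (transposition s z (transposition r y p))
     + a r * w (transposition s z y) + a s * w z = b" for y z
    using c[of y z] dist unfolding V by (auto simp: Transposition.transpose_def split: if_splits)
  have neq: "p \<noteq> q" "q \<noteq> p" "p \<noteq> r" "r \<noteq> p" "p \<noteq> s" "s \<noteq> p" "q \<noteq> r" "r \<noteq> q" "q \<noteq> s" "s \<noteq> q"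
    "r \<noteq> s" "s \<noteq> r"
    using dist by auto
  show ?thesis
  proof (rule weights_constant_four_algebra[OF ne])
    show "a p * w q + a q * w r + a r * w s + a s * w p = b"
      using eqs[of p p] by (simp add: Transposition.transpose_def neq)
    show "a q * w p + a r * w q + a s * w r + a p * w s = b"
      using eqs[of r q] by (simp add: Transposition.transpose_def neq)
    show "a p * w r + a r * w q + a q * w s + a s * w p = b"
      using eqs[of p q] by (simp add: Transposition.transpose_def neq)
    show "a r * w p + a q * w r + a s * w q + a p * w s = b"
      using eqs[of q p] by (simp add: Transposition.transpose_def neq)
    show "a p * w q + a q * w s + a s * w r + a r * w p = b"
      using eqs[of r p] by (simp add: Transposition.transpose_def neq)
    show "a q * w p + a s * w q + a r * w s + a p * w r = b"
      using eqs[of q q] by (simp add: Transposition.transpose_def neq)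
  qed
qed

text \<open>
  With more than four nodes, some node \<open>c\<close> other than \<open>i\<close> and \<open>j\<close> can be contracted along \<open>c \<rightarrow> i\<close>. With
  three nodes the claim fails: the two reverse cycles give a single equation.
\<close>

lemma weights_constant_all:
  fixes a w :: "'a \<Rightarrow> real"
  assumes "finite V" "4 \<le> card V" "inj_on w V"
    and "\<And>\<sigma>. single_cycle \<sigma> V \<Longrightarrow> (\<Sum>x\<in>V. a x * w (\<sigma> x)) = b"
    and "i \<in> V" "j \<in> V"
  shows "a i = a j"
  using assms
proof (induction V arbitrary: w b rule: finite_psubset_induct)
  case (psubset V)
  have card2: "card (V - {i, j}) \<ge> 2"
    using psubset.prems diff_card_le_card_Diff[of "{i, j}" V] by (simp add: card_insert_if split: if_splits)
  show ?case
  proof (cases "i = j \<or> card V = 4")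
    case True
    show ?thesis
    proof (cases "i = j")
      case False
      then have "card (V - {i, j}) = 2" using True psubset by (simp add: card_Diff_subset)
      then obtain r s where rs: "V - {i, j} = {r, s}" "r \<noteq> s" by (auto simp: card_2_iff)
      have V: "V = {i, j, r, s}" and dist: "distinct [i, j, r, s]"
        using rs False psubset.prems by auto
      show ?thesis by (rule weights_constant_four[OF dist V psubset.prems(2,3)])
    qed simp
  next
    case False
    have "V - {i, j} \<noteq> {}"
    proof
      assume "V - {i, j} = {}"
      then show False using card2 by (simp only: card.empty)
    qed
    then obtain c where c: "c \<in> V" "c \<noteq> i" "c \<noteq> j" by auto
    have ins: "insert c (V - {c}) = V" using c by auto
    show ?thesis
    proof (rule psubset.IH[of "V - {c}" "w \<circ> transposition c i" "b - a c * w i"])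
      have "4 < card V" using psubset.prems(1) False by linarith
      then show "4 \<le> card (V - {c})" using c psubset.hyps by (simp add: card_Diff_singleton)
      have "inj_on (w \<circ> transposition c i) V"
        using psubset.prems(2) c psubset.prems(4) by (intro comp_inj_on) auto
      then show "inj_on (w \<circ> transposition c i) (V - {c})" by (rule inj_on_subset) auto
      show "(\<Sum>x\<in>V - {c}. a x * (w \<circ> transposition c i) (\<tau> x)) = b - a c * w i"
        if \<tau>: "single_cycle \<tau> (V - {c})" for \<tau>
        using sum_insert_node[OF \<tau>, of c a w i] psubset.prems(3)[of "transposition c i \<circ> \<tau>"]
          single_cycle_insert[OF \<tau>, of c i] c psubset.prems(4) unfolding ins
        by (simp del: o_apply)
    qed (use c psubset.prems in auto)
  qed
qed

section \<open>Cycles with prescribed arcs\<close>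

text \<open>
  Acyclicity of the prescribed arcs is witnessed by a rank \<open>r\<close> that strictly decreases along them,
  a form that survives contraction with the same \<open>r\<close>.
\<close>

definition acyclic_assignment :: "('a \<Rightarrow> nat) \<Rightarrow> ('a \<Rightarrow> 'a) \<Rightarrow> 'a set \<Rightarrow> 'a set \<Rightarrow> bool" where
  "acyclic_assignment r f J V \<longleftrightarrow>
     J \<subseteq> V \<and> inj_on f J \<and> f ` J \<subseteq> V \<and> (\<forall>x\<in>J. r (f x) < r x)"

text \<open>
  Contracting the prescribed arc \<open>c \<rightarrow> f c\<close> redirects the arc that enters \<open>c\<close>, if any, to \<open>f c\<close>.
\<close>

lemma acyclic_assignment_remove:
  assumes f: "acyclic_assignment r f J V" and c: "c \<in> J"
  shows "acyclic_assignment r (transposition c (f c) \<circ> f) (J - {c}) (V - {c})"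
proof -
  have J: "J \<subseteq> V" and inj: "inj_on f J" and im: "f ` J \<subseteq> V" and r: "\<And>x. x \<in> J \<Longrightarrow> r (f x) < r x"
    using f by (auto simp: acyclic_assignment_def)
  have fc: "f c \<noteq> c" using r[OF c] by auto
  have *: "(transposition c (f c) \<circ> f) x = (if f x = c then f c else f x)" if "x \<in> J - {c}" for x
    using that c inj by (auto simp: Transposition.transpose_def dest: inj_onD)
  have "inj_on (transposition c (f c) \<circ> f) (J - {c})"
    by (rule comp_inj_on) (auto intro: inj_on_subset[OF inj] inj_on_subset[OF inj_transpose])
  moreover have "r ((transposition c (f c) \<circ> f) x) < r x" if "x \<in> J - {c}" for x
    using r[of x] r[OF c] that unfolding *[OF that] by auto
  moreover have "(transposition c (f c) \<circ> f) ` (J - {c}) \<subseteq> V - {c}"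
    using im fc c * by auto
  ultimately show ?thesis using J by (auto simp: acyclic_assignment_def)
qed

text \<open>Inserting \<open>c\<close> again turns an extension of the contracted arcs into one of the original arcs.\<close>

lemma extension_insert:
  assumes f: "acyclic_assignment r f J V" and c: "c \<in> J"
    and \<tau>: "single_cycle \<tau> (V - {c})" and ext: "\<And>x. x \<in> J - {c} \<Longrightarrow> \<tau> x = (transposition c (f c) \<circ> f) x"
  shows "single_cycle (transposition c (f c) \<circ> \<tau>) V \<and> (\<forall>x\<in>J. (transposition c (f c) \<circ> \<tau>) x = f x)"
proof -
  have fc: "f c \<in> V - {c}" and cV: "c \<in> V"
    using f c by (auto simp: acyclic_assignment_def)
  have "single_cycle (transposition c (f c) \<circ> \<tau>) V"
    using single_cycle_insert[OF \<tau> _ fc, of c] insert_Diff[OF cV] by simp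
  moreover have "\<tau> c = c"
    using \<tau> permutes_not_in[of \<tau> "V - {c}" c] by (simp add: single_cycle_def)
  ultimately show ?thesis using ext by fastforce
qed

lemma acyclic_assignment_extends:
  assumes "finite V" "V - J \<noteq> {}" "acyclic_assignment r f J V"
  shows "\<exists>\<sigma>. single_cycle \<sigma> V \<and> (\<forall>x\<in>J. \<sigma> x = f x)"
  using assms
proof (induction V arbitrary: J f rule: finite_psubset_induct)
  case (psubset V)
  show ?case
  proof (cases "J = {}")
    case True
    from psubset.prems obtain c where c: "c \<in> V" by auto
    show ?thesis
    proof (cases "V = {c}")
      case True
      then show ?thesis using single_cycle_singleton[of c] \<open>J = {}\<close> by blast
    next
      case False
      then obtain d where d: "d \<in> V - {c}" using c by auto
      have "acyclic_assignment r f {} (V - {c})" by (simp add: acyclic_assignment_def)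
      then obtain \<tau> where "single_cycle \<tau> (V - {c})"
        using psubset.IH[of "V - {c}" "{}" f] c d by auto
      from single_cycle_insert[OF this _ d, of c] show ?thesis
        using \<open>J = {}\<close> insert_Diff[OF c] by auto
    qed
  next
    case False
    then obtain c where c: "c \<in> J" by auto
    have sub: "V - {c} \<subset> V" "V - {c} - (J - {c}) = V - J"
      using c psubset.prems by (auto simp: acyclic_assignment_def)
    obtain \<tau> where "single_cycle \<tau> (V - {c})" "\<forall>x\<in>J - {c}. \<tau> x = (transposition c (f c) \<circ> f) x"
      using psubset.IH[OF sub(1) _ acyclic_assignment_remove[OF psubset.prems(2) c]] sub(2) psubset.prems
      by auto
    then show ?thesis using extension_insert[OF psubset.prems(2) c, of \<tau>] by blast
  qed
qed

text \<open>
  Contracting the prescribed arcs one after another leaves an unrestricted problem on \<open>V - J\<close>.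
\<close>

lemma weights_constant_off_assignment:
  fixes a w :: "'a \<Rightarrow> real"
  assumes "finite V" "4 \<le> card (V - J)" "acyclic_assignment r f J V" "inj_on w V"
    and "\<And>\<sigma>. single_cycle \<sigma> V \<Longrightarrow> \<forall>x\<in>J. \<sigma> x = f x \<Longrightarrow> (\<Sum>x\<in>V. a x * w (\<sigma> x)) = b"
    and "i \<in> V - J" "j \<in> V - J"
  shows "a i = a j"
  using assms
proof (induction V arbitrary: J f w b rule: finite_psubset_induct)
  case (psubset V)
  show ?case
  proof (cases "J = {}")
    case True
    then show ?thesis using psubset weights_constant_all[of V w a b i j] by auto
  next
    case False
    then obtain c where c: "c \<in> J" by auto
    note rm = acyclic_assignment_remove[OF psubset.prems(2) c]
    have cV: "c \<in> V" "f c \<in> V" using c psubset.prems by (auto simp: acyclic_assignment_def)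
    have sub: "V - {c} \<subset> V" "V - {c} - (J - {c}) = V - J" "insert c (V - {c}) = V"
      using c cV by auto
    have inj: "inj_on (w \<circ> transposition c (f c)) (V - {c})"
    proof (rule inj_on_subset[OF comp_inj_on])
      show "inj_on w (transposition c (f c) ` V)" using cV psubset.prems by simp
    qed auto
    show ?thesis
    proof (rule psubset.IH[OF sub(1) _ rm inj, of "b - a c * w (f c)", unfolded sub(2)])
      show "(\<Sum>x\<in>V - {c}. a x * (w \<circ> transposition c (f c)) (\<tau> x)) = b - a c * w (f c)"
        if \<tau>: "single_cycle \<tau> (V - {c})" "\<forall>x\<in>J - {c}. \<tau> x = (transposition c (f c) \<circ> f) x" for \<tau>
        using sum_insert_node[OF \<tau>(1), of c a w "f c"]
          extension_insert[OF psubset.prems(2) c \<tau>(1)] \<tau>(2)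
          psubset.prems(4)[of "transposition c (f c) \<circ> \<tau>"] unfolding sub(3)
        by (auto simp del: o_apply)
    qed (use psubset.prems in auto)
  qed
qed


section \<open>Weights that do not distinguish tight circuits\<close>

lemma rank_bij_betw:
  fixes J :: "nat set"
  assumes "finite J"
  shows "bij_betw (\<lambda>x. card {y \<in> J. y \<le> x}) J {1..card J}"
proof -
  let ?h = "\<lambda>x. card {y \<in> J. y \<le> x}"
  have less: "?h x < ?h y" if "x \<in> J" "y \<in> J" "x < y" for x y
  proof (rule psubset_card_mono)
    have "y \<in> {z \<in> J. z \<le> y}" "y \<notin> {z \<in> J. z \<le> x}" using that by auto
    moreover have "{z \<in> J. z \<le> x} \<subseteq> {z \<in> J. z \<le> y}" using that(3) by auto
    ultimately show "{z \<in> J. z \<le> x} \<subset> {z \<in> J. z \<le> y}" by blast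
  qed (simp add: assms)
  have inj: "inj_on ?h J"
    using less by (intro linorder_inj_onI) (auto dest: less_imp_neq)
  have "?h x \<in> {1..card J}" if "x \<in> J" for x
  proof -
    have "0 < ?h x" using that assms by (auto simp: card_gt_0_iff)
    moreover have "?h x \<le> card J" using assms by (intro card_mono) auto
    ultimately show ?thesis by simp
  qed
  then have "?h ` J = {1..card J}"
    using card_image[OF inj] by (intro card_subset_eq) auto
  then show ?thesis using inj by (simp add: bij_betw_def)
qed

text \<open>The elements of \<open>J\<close> up to \<open>x\<close> all lie in \<open>{3..x}\<close>.\<close>

lemma rank_add_2_le:
  fixes J :: "nat set"
  assumes "\<forall>j\<in>J. 2 < j" "x \<in> J"
  shows "card {y \<in> J. y \<le> x} + 2 \<le> x"
proof -
  have "card {y \<in> J. y \<le> x} \<le> card {3..x}" using assms(1) by (intro card_mono) auto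
  then show ?thesis using assms by auto
qed

text \<open>
  The two sides are treated one after the other: the complement of \<open>J\<close> by fixing \<open>\<sigma>\<close> on \<open>J\<close> to be
  the rank function \<open>h\<close>, then \<open>J\<close> by comparing \<open>h\<close> with its composition with the exchange of two
  consecutive ranks. In the second part only \<open>a - d\<close> matters, which vanishes off \<open>J\<close>, so that the
  choice of the extending cycle has no influence.
\<close>

lemma weights_two_valued:
  fixes a v :: "nat \<Rightarrow> real"
  assumes J: "J \<subseteq> {1..n}" and big: "\<forall>j\<in>J. 2 < j" and card: "card J + 4 \<le> n"
    and inj: "inj_on v {1..n}"
    and const: "\<And>\<sigma>. single_cycle \<sigma> {1..n} \<Longrightarrow> \<sigma> ` J = {1..card J} \<Longrightarrow>
      (\<Sum>x\<in>{1..n}. a x * v (\<sigma> x)) = b"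
  obtains c d where "\<forall>i\<in>J. a i = c" "\<forall>i\<in>{1..n} - J. a i = d"
proof -
  let ?V = "{1..n}" and ?m = "card J"
  have fin: "finite J" using J finite_subset by blast
  have card4: "4 \<le> card (?V - J)" using card J fin by (simp add: card_Diff_subset)
  have off: "?V - J \<noteq> {}"
  proof
    assume "?V - J = {}"
    then show False using card4 by (simp only: card.empty)
  qed
  define h where "h x = card {y \<in> J. y \<le> x}" for x
  have h: "bij_betw h J {1..?m}" unfolding h_def by (rule rank_bij_betw[OF fin])
  have h_le: "h x + 2 \<le> x" if "x \<in> J" for x
    unfolding h_def using rank_add_2_le big that by blast
  have assignment: "acyclic_assignment (\<lambda>x. x) f J ?V"
    if "bij_betw f J {1..?m}" "\<And>x. x \<in> J \<Longrightarrow> f x < x" for f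
    using that J card by (auto simp: acyclic_assignment_def bij_betw_def)
  have const': "(\<Sum>x\<in>?V. a x * v (\<sigma> x)) = b"
    if f: "bij_betw f J {1..?m}" and \<sigma>: "single_cycle \<sigma> ?V" "\<forall>x\<in>J. \<sigma> x = f x" for f \<sigma>
  proof (rule const[OF \<sigma>(1)])
    show "\<sigma> ` J = {1..?m}" using f \<sigma>(2) by (simp add: bij_betw_def)
  qed
  have h_less: "h x < x" if "x \<in> J" for x using h_le[OF that] by simp
  obtain d where d: "\<forall>i\<in>?V - J. a i = d"
    using weights_constant_off_assignment[OF _ card4 assignment[OF h h_less] inj const'[OF h]]
    by (metis finite_atLeastAtMost)
  define a' where "a' x = a x - d" for x
  have on_J: "(\<Sum>x\<in>J. a' x * v (f x)) = b - d * (\<Sum>x\<in>?V. v x)"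
    if f: "bij_betw f J {1..?m}" "\<And>x. x \<in> J \<Longrightarrow> f x < x" for f
  proof -
    obtain \<sigma> where \<sigma>: "single_cycle \<sigma> ?V" "\<forall>x\<in>J. \<sigma> x = f x"
      using acyclic_assignment_extends[OF _ off assignment[OF f]] by blast
    have "(\<Sum>x\<in>?V. v (\<sigma> x)) = (\<Sum>x\<in>?V. v x)"
      using \<sigma>(1) by (intro sum.reindex_bij_betw permutes_imp_bij) (simp add: single_cycle_def)
    then have "(\<Sum>x\<in>?V. a' x * v (\<sigma> x)) = b - d * (\<Sum>x\<in>?V. v x)"
      using const'[OF f(1) \<sigma>]
      by (simp add: a'_def algebra_simps sum_subtractf flip: sum_distrib_left)
    moreover have "(\<Sum>x\<in>?V. a' x * v (\<sigma> x)) = (\<Sum>x\<in>J. a' x * v (\<sigma> x))"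
      using J d by (intro sum.mono_neutral_right) (auto simp: a'_def)
    moreover have "\<dots> = (\<Sum>x\<in>J. a' x * v (f x))" using \<sigma>(2) by simp
    ultimately show ?thesis by simp
  qed
  let ?p = "inv_into J h"
  have p: "?p k \<in> J" "h (?p k) = k" if "k \<in> {1..?m}" for k
    using h that by (auto simp: bij_betw_def inv_into_into f_inv_into_f)
  have consecutive: "a (?p k) = a (?p (Suc k))" if k: "1 \<le> k" "Suc k \<le> ?m" for k
  proof -
    let ?s = "transposition k (Suc k)"
    let ?x = "?p k" and ?y = "?p (Suc k)"
    have x: "?x \<in> J" "h ?x = k" and y: "?y \<in> J" "h ?y = Suc k" using p k by auto
    have "bij_betw (?s \<circ> h) J {1..?m}"
      using h k by (intro bij_betw_trans[OF h] permutes_imp_bij permutes_swap_id) auto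
    \<comment> \<open>The exchange raises a rank by at most one, and \<open>h z\<close> leaves room for two.\<close>
    moreover have "(?s \<circ> h) z < z" if "z \<in> J" for z
      using h_le[OF that] by (auto simp: Transposition.transpose_def)
    ultimately have "(\<Sum>z\<in>J. a' z * v ((?s \<circ> h) z)) = (\<Sum>z\<in>J. a' z * v (h z))"
      using on_J[OF h h_less] on_J[of "?s \<circ> h"] by simp
    then have "(\<Sum>z\<in>J. a' z * (v ((?s \<circ> h) z) - v (h z))) = 0"
      by (simp add: right_diff_distrib sum_subtractf)
    moreover have "(\<Sum>z\<in>J. a' z * (v ((?s \<circ> h) z) - v (h z)))
        = (\<Sum>z\<in>{?x, ?y}. a' z * (v ((?s \<circ> h) z) - v (h z)))"
    proof (rule sum.mono_neutral_right)
      show "\<forall>z\<in>J - {?x, ?y}. a' z * (v ((?s \<circ> h) z) - v (h z)) = 0"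
      proof
        fix z assume z: "z \<in> J - {?x, ?y}"
        have "inj_on h J" using h by (simp add: bij_betw_def)
        then have "h z \<noteq> h ?x" "h z \<noteq> h ?y"
          using z x(1) y(1) by (auto simp: inj_on_eq_iff simp del: x(2) y(2))
        then have "h z \<noteq> k" "h z \<noteq> Suc k" unfolding x(2) y(2) by simp_all
        then show "a' z * (v ((?s \<circ> h) z) - v (h z)) = 0" by simp
      qed
    qed (use fin x y in auto)
    moreover have "?x \<noteq> ?y" using x y by auto
    ultimately have "(a' ?x - a' ?y) * (v (Suc k) - v k) = 0"
      using x y by (simp add: algebra_simps)
    moreover have "v (Suc k) \<noteq> v k" using inj k card by (auto dest: inj_onD)
    ultimately show ?thesis by (simp add: a'_def)
  qed
  have chain: "a (?p k) = a (?p 1)" if "1 \<le> k" "k \<le> ?m" for k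
    using that
  proof (induction k rule: dec_induct)
    case (step k)
    then show ?case using consecutive[of k] by simp
  qed simp
  have "\<forall>i\<in>J. a i = a (?p 1)"
  proof
    fix i assume i: "i \<in> J"
    then have "h i \<in> {1..?m}" "?p (h i) = i" using h by (auto simp: bij_betw_def)
    then show "a i = a (?p 1)" using chain[of "h i"] by simp
  qed
  then show ?thesis using d that by blast
qed

section \<open>From weights to the facet\<close>

text \<open>The \<open>k\<close>-th smallest element of \<open>S\<close> is at least \<open>k\<close>.\<close>

lemma sum_smallest_le:
  fixes v :: "nat \<Rightarrow> real"
  assumes "S \<subseteq> {1..n}" and v: "mono_on {1..n} v"
  shows "(\<Sum>k=1..card S. v k) \<le> (\<Sum>k\<in>S. v k)"
proof -
  let ?h = "\<lambda>x. card {y \<in> S. y \<le> x}"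
  have fin: "finite S" using assms(1) finite_subset by blast
  note h = rank_bij_betw[OF fin]
  have "(\<Sum>k=1..card S. v k) = (\<Sum>x\<in>S. v (?h x))"
    by (rule sum.reindex_bij_betw[OF h, symmetric])
  also have "\<dots> \<le> (\<Sum>x\<in>S. v x)"
  proof (rule sum_mono)
    fix x assume x: "x \<in> S"
    have "?h x \<in> {1..card S}" using h x by (auto simp: bij_betw_def)
    moreover have "?h x \<le> card {1..x}" using assms(1) by (intro card_mono) auto
    moreover have "x \<in> {1..n}" using assms(1) x by auto
    ultimately show "v (?h x) \<le> v x" by (intro mono_onD[OF v]) auto
  qed
  finally show ?thesis .
qed

text \<open>
  A lower bound for the dimension from an upper bound for the normals: the vectors with constant
  inner product on \<open>C\<close> are the orthogonal complement of the directions of \<open>C\<close>.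
\<close>

lemma aff_dim_ge_codim:
  fixes C :: "'a::euclidean_space set"
  assumes x0: "x0 \<in> C" and fin: "finite D"
    and normals: "\<And>y. (\<And>x. x \<in> C \<Longrightarrow> y \<bullet> x = y \<bullet> x0) \<Longrightarrow> y \<in> span D"
  shows "int DIM('a) \<le> aff_dim C + int (card D)"
proof -
  let ?S = "span ((\<lambda>x. x - x0) ` C)"
  have "dim {y \<in> UNIV. \<forall>x\<in>?S. orthogonal x y} + dim ?S = dim (UNIV :: 'a set)"
    by (rule dim_subspace_orthogonal_to_vectors) auto
  moreover have "{y \<in> UNIV. \<forall>x\<in>?S. orthogonal x y} \<subseteq> span D"
  proof
    fix y assume "y \<in> {y \<in> UNIV. \<forall>x\<in>?S. orthogonal x y}"
    then have "(x - x0) \<bullet> y = 0" if "x \<in> C" for x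
      using that by (auto simp: orthogonal_def intro!: span_base)
    then show "y \<in> span D"
      by (intro normals) (simp add: inner_diff_left inner_commute[of y])
  qed
  then have "dim {y \<in> UNIV. \<forall>x\<in>?S. orthogonal x y} \<le> card D"
    by (rule dim_le_card[OF _ fin])
  moreover have "aff_dim C = int (dim ?S)"
    using aff_dim_eq_dim_subtract[of x0 C] hull_inc[OF x0] by simp
  ultimately show ?thesis by simp
qed

theorem theorem11:
  fixes e :: "nat \<Rightarrow> 'n::finite" and v :: "nat \<Rightarrow> real" and J :: "nat set"
  assumes "bij_betw e {1..CARD('n)} UNIV"
    and "0 \<le> v 1"
    and "strict_mono_on {1..CARD('n)} v"
    and "J \<subseteq> {1..CARD('n)}"
    and "1 \<le> card J"
    and "card J + 4 \<le> CARD('n)"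
    and "\<forall>j\<in>J. j > 2"
  shows "defines_facet (circuit_polytope e v)
           (\<lambda>x. \<Sum>j\<in>J. x $ e j) (\<Sum>j=1..card J. v j)"
proof -
  let ?V = "{1..CARD('n)}"
  let ?b = "\<Sum>j=1..card J. v j"
  let ?P = "circuit_polytope e v"
  let ?F = "{x \<in> ?P. (\<Sum>j\<in>J. x $ e j) = ?b}"
  note e = assms(1) and J = assms(4)
  have finJ: "finite J" using J finite_subset by blast
  have inj: "inj_on v ?V" using assms(3) by (rule strict_mono_on_imp_inj_on)
  have mono: "mono_on ?V v" using assms(3) by (rule strict_mono_on_imp_mono_on)
  have e_inj: "e i = e j \<longleftrightarrow> i = j" if "i \<in> ?V" "j \<in> ?V" for i j
    using e that by (auto simp: bij_betw_def dest: inj_onD)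
  have e_surj: "\<exists>i\<in>?V. k = e i" for k
    using e by (auto simp: bij_betw_def)
  have coords: "(\<Sum>k\<in>UNIV. g k) = (\<Sum>i\<in>?V. g (e i))" for g :: "'n \<Rightarrow> real"
    by (rule sum.reindex_bij_betw[OF e, symmetric])

  define circ :: "(nat \<Rightarrow> nat) \<Rightarrow> real ^ 'n" where
    "circ \<sigma> = (\<chi> k. v (\<sigma> (inv_into ?V e k)))" for \<sigma>
  have circ: "circ \<sigma> $ e i = v (\<sigma> i)" if "i \<in> ?V" for \<sigma> i
    using e that by (simp add: circ_def bij_betw_def)
  have circuits: "{x. is_circuit e v x} = circ ` {\<sigma>. single_cycle \<sigma> ?V}"
  proof (intro equalityI subsetI)
    fix x assume "x \<in> {x. is_circuit e v x}"
    then obtain \<sigma> where \<sigma>: "single_cycle \<sigma> ?V" "\<forall>i\<in>?V. x $ e i = v (\<sigma> i)"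
      by (auto simp: is_circuit_def single_cycle_def)
    have "x = circ \<sigma>" unfolding vec_eq_iff using e_surj \<sigma>(2) circ by metis
    then show "x \<in> circ ` {\<sigma>. single_cycle \<sigma> ?V}" using \<sigma>(1) by blast
  qed (use circ in \<open>auto simp: is_circuit_def single_cycle_def\<close>)
  have inner_circ: "y \<bullet> circ \<sigma> = (\<Sum>i\<in>?V. y $ e i * v (\<sigma> i))" for y \<sigma>
    unfolding inner_vec_def coords using circ by simp
  have circ_in_P: "circ \<sigma> \<in> ?P" if "single_cycle \<sigma> ?V" for \<sigma>
    unfolding circuit_polytope_def circuits using that by (intro hull_inc) simp

  \<comment> \<open>\<open>u\<close> is the normal of the inequality and \<open>one\<close> the normal of the hyperplane containing the polytope.\<close>
  define u :: "real ^ 'n" where "u = (\<chi> k. if k \<in> e ` J then 1 else 0)"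
  define one :: "real ^ 'n" where "one = (\<chi> k. 1)"
  have u: "u $ e i = (if i \<in> J then 1 else 0)" if "i \<in> ?V" for i
    using that J e_inj by (auto simp: u_def)
  have inner_u: "u \<bullet> x = (\<Sum>j\<in>J. x $ e j)" for x
  proof -
    have "u \<bullet> x = (\<Sum>i\<in>?V. if i \<in> J then x $ e i else 0)"
      unfolding inner_vec_def coords using u by (intro sum.cong) auto
    also have "\<dots> = (\<Sum>j\<in>J. x $ e j)"
      using J by (simp add: sum.If_cases Int_absorb1)
    finally show ?thesis .
  qed
  have u_circ: "u \<bullet> circ \<sigma> = (\<Sum>k\<in>\<sigma> ` J. v k)" if "single_cycle \<sigma> ?V" for \<sigma>
  proof -
    have "inj_on \<sigma> J" using that permutes_inj_on by (auto simp: single_cycle_def)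
    then have "(\<Sum>k\<in>\<sigma> ` J. v k) = (\<Sum>j\<in>J. v (\<sigma> j))" by (simp add: sum.reindex)
    also have "\<dots> = (\<Sum>j\<in>J. circ \<sigma> $ e j)" using J circ by (intro sum.cong) auto
    finally show ?thesis by (simp add: inner_u)
  qed

  have P_ge: "?P \<subseteq> {x. u \<bullet> x \<ge> ?b}"
    unfolding circuit_polytope_def
  proof (rule hull_minimal)
    show "{x. is_circuit e v x} \<subseteq> {x. u \<bullet> x \<ge> ?b}"
      unfolding circuits
    proof clarify
      fix \<sigma> assume \<sigma>: "single_cycle \<sigma> ?V"
      have "inj_on \<sigma> J" "\<sigma> ` J \<subseteq> ?V"
        using \<sigma> J permutes_inj_on image_mono[OF J, of \<sigma>] permutes_image[of \<sigma> ?V]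
        by (auto simp only: single_cycle_def)
      then show "?b \<le> u \<bullet> circ \<sigma>"
        using sum_smallest_le[OF _ mono, of "\<sigma> ` J"] u_circ[OF \<sigma>] by (simp add: card_image)
    qed
  qed (rule convex_halfspace_ge)
  have P_eq: "?P \<subseteq> {x. one \<bullet> x = (\<Sum>k\<in>?V. v k)}"
    unfolding circuit_polytope_def
  proof (rule hull_minimal)
    show "{x. is_circuit e v x} \<subseteq> {x. one \<bullet> x = (\<Sum>k\<in>?V. v k)}"
      unfolding circuits inner_circ
    proof (clarsimp simp: inner_circ one_def)
      fix \<sigma> assume "single_cycle \<sigma> {Suc 0..CARD('n)}"
      then show "(\<Sum>i = Suc 0..CARD('n). v (\<sigma> i)) = (\<Sum>k = Suc 0..CARD('n). v k)"
        by (intro sum.reindex_bij_betw permutes_imp_bij) (simp add: single_cycle_def)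
    qed
  qed (rule convex_hyperplane)

  have F_eq: "?F = ?P \<inter> {x. u \<bullet> x = ?b}" by (auto simp: inner_u)
  have convP: "convex ?P" unfolding circuit_polytope_def by (rule convex_convex_hull)
  have face: "?F face_of ?P"
    unfolding F_eq using P_ge by (intro face_of_Int_supporting_hyperplane_ge convP) auto

  \<comment> \<open>Otherwise \<open>u\<close> would not distinguish any circuits and would be constant.\<close>
  have "?F \<noteq> ?P"
  proof
    assume FP: "?F = ?P"
    have const: "(\<Sum>i\<in>?V. u $ e i * v (\<sigma> i)) = ?b" if "single_cycle \<sigma> ?V" for \<sigma>
      using circ_in_P[OF that] FP unfolding F_eq inner_circ[symmetric] by blast
    obtain j where j: "j \<in> J" using assms(5) by fastforce
    have "u $ e j = u $ e 1"
      by (rule weights_constant_all[where a = "\<lambda>i. u $ e i", OF _ _ inj const]) (use j J assms(6) in auto)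
    moreover have "1 \<notin> J" using assms(7) by auto
    ultimately show False using u[of j] u[of 1] j J by auto
  qed
  then have "aff_dim ?F < aff_dim ?P"
    by (rule face_of_aff_dim_lt[OF convP face])
  moreover have "aff_dim ?P \<le> int CARD('n) - 1"
  proof -
    have "one \<noteq> 0" by (simp add: one_def vec_eq_iff)
    then show ?thesis
      using aff_dim_subset[OF P_eq] by (simp add: aff_dim_hyperplane)
  qed
  moreover
  let ?C = "circ ` {\<sigma>. single_cycle \<sigma> ?V \<and> \<sigma> ` J = {1..card J}}"
  have C_sub: "?C \<subseteq> ?F"
    unfolding F_eq using circ_in_P u_circ by auto
  obtain x0 where x0: "x0 \<in> ?C"
  proof -
    let ?h = "\<lambda>x. card {y \<in> J. y \<le> x}"
    note h = rank_bij_betw[OF finJ]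
    have "?h x < x" if "x \<in> J" for x
      using rank_add_2_le[OF assms(7) that] by simp
    then have "acyclic_assignment (\<lambda>x. x) ?h J ?V"
      using h J assms(6) by (auto simp: acyclic_assignment_def bij_betw_def)
    moreover have "1 \<in> ?V - J" using assms(6,7) by auto
    then have "?V - J \<noteq> {}" by blast
    ultimately obtain \<sigma> where "single_cycle \<sigma> ?V" "\<forall>x\<in>J. \<sigma> x = ?h x"
      using acyclic_assignment_extends[of ?V J "\<lambda>x. x" ?h] by blast
    then have "circ \<sigma> \<in> ?C" using h by (auto simp: bij_betw_def)
    then show ?thesis using that by blast
  qed
  have "int DIM(real ^ 'n) \<le> aff_dim ?C + int (card {u, one - u})"
  proof (rule aff_dim_ge_codim[OF x0])
    fix y assume y: "\<And>x. x \<in> ?C \<Longrightarrow> y \<bullet> x = y \<bullet> x0"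
    obtain c d where cd: "\<forall>i\<in>J. y $ e i = c" "\<forall>i\<in>?V - J. y $ e i = d"
    proof (rule weights_two_valued[OF J assms(7,6) inj, of "\<lambda>i. y $ e i"])
      show "(\<Sum>i\<in>?V. y $ e i * v (\<sigma> i)) = y \<bullet> x0"
        if "single_cycle \<sigma> ?V" "\<sigma> ` J = {1..card J}" for \<sigma>
        using y[of "circ \<sigma>"] that inner_circ[of y \<sigma>] by auto
    qed
    have "y $ k = (c *\<^sub>R u + d *\<^sub>R (one - u)) $ k" for k
    proof -
      obtain i where "i \<in> ?V" "k = e i" using e_surj by blast
      then show ?thesis using cd u[of i] by (simp add: one_def)
    qed
    then have "y = c *\<^sub>R u + d *\<^sub>R (one - u)" by (simp add: vec_eq_iff)
    then show "y \<in> span {u, one - u}"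
      by (simp add: span_add span_scale span_base)
  qed simp
  moreover have "card {u, one - u} \<le> 2" by (simp add: card_insert_if)
  moreover have "aff_dim ?C \<le> aff_dim ?F" by (rule aff_dim_subset[OF C_sub])
  ultimately have "aff_dim ?F = aff_dim ?P - 1" by simp
  moreover have "?F \<noteq> {}" using x0 C_sub by auto
  ultimately have "?F facet_of ?P" using face by (simp add: facet_of_def)
  moreover have "\<forall>x\<in>?P. (\<Sum>j\<in>J. x $ e j) \<ge> ?b" using P_ge by (auto simp: inner_u)
  ultimately show ?thesis unfolding defines_facet_def by blast
qed

end
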